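(* Let $f:\mathbb{R}^d\times\mathbb{R}^m\to\mathbb{R}^d$ be continuous and $L\in C^2(\mathbb{R}^d\times\mathbb{R}^m;\mathbb{R})$ satisfy assumptions (F0), (L1), (L2), (L3) and (LUGC) stated in the context. Then there exists a constant $\alpha(L)\in\mathbb{R}$ (called the critical constant, or Mañé's critical value) such that $$\lim_{T\to\infty}\ \sup_{x\in\overline{B}_R}\left|\frac1T V_T(x)-\alpha(L)\right|=0\qquad\text{for all } R>0,$$ where $V_T(x)=\inf_{(\gamma,u)\in\Gamma_{0,T}^{x\to}}\int_0^T L(\gamma(s),u(s))\,ds$.
   Context: Notation: $|\cdot|$ is the Euclidean norm, $\overline{B}_R$ the closed ball of radius $R$ centered at $0$ in $\mathbb{R}^d$. For $s_0<s_1$ and $x,y\in\mathbb{R}^d$, $\Gamma_{s_0,s_1}^{x\to}$ is the set of pairs $(\gamma,u)\in AC([s_0,s_1];\mathbb{R}^d)\times L^2(s_0,s_1;\mathbb{R}^m)$ with $\dot\gamma(t)=f(\gamma(t),u(t))$ for a.e. $t$ and $\gamma(s_0)=x$; $\Gamma_{s_0,s_1}^{\to y}$ is the same with $\gamma(s_1)=y$ in place of $\gamma(s_0)=x$; $\Gamma_{s_0,s_1}^{x\to y}=\Gamma_{s_0,s_1}^{x\to}\cap\Gamma_{s_0,s_1}^{\to y}$. Assumptions: (F0) There is $c_f\ge0$ with $|f(x,u)-f(y,u)|\le c_f(1+|u|)|x-y|$ and $|f(x,u)|\le c_f(1+|u|)(1+|x|)$ for all $x,y\in\mathbb{R}^d$,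 $u\in\mathbb{R}^m$. (L1) There are a nondecreasing function $\beta:[0,\infty)\to\mathbb{R}$ and a constant $\ell_1>0$ such that for all $(x,u)$: $L(x,u)\le\beta(|x|)(1+|u|^2)$, $|D_xL(x,u)|\le\ell_1(1+|u|^2)$, and $D_u^2L(x,u)\ge\frac1{\ell_1}$ (in the sense of quadratic forms). (L2) There is $u^*\in\mathbb{R}^m$ such that $L(x,u)\ge L(x,u^* )$ for all $(x,u)\in\mathbb{R}^d\times\mathbb{R}^m$. (L3) There are a compact set $\mathcal{K}\subset\mathbb{R}^d$ and a constant $\Theta>0$ such that $\inf_{x\in\mathbb{R}^d\setminus\mathcal{K}}L(x,u)\ge\Theta+\min_{x\in\mathcal{K}}L(x,u^* )$ for every $u\in\mathbb{R}^m$, and there is $x^*\in\operatorname{argmin}_{x\in\mathcal{K}}L(x,u^* )$ with $f(x^*,u^* )=0$. (LUGC) (local uniform global controllability) For every $R\ge0$ there are $T_R\ge0$ and $C_R\ge0$ such that for all $x,y\in\overline{B}_R$ there is $(\gamma_{x\to y},u_{x\to y})\in\Gamma_{0,T_R}^{x\to y}$ with $\int_0^{T_R}|u_{x\to y}(s)|^2\,ds\le C_R$. *)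

theory Defs
  imports "HOL-Analysis.Analysis"
begin

text \<open>The state space is \<open>real ^ 'd\<close>, the control space \<open>real ^ 'm\<close>; the dynamics \<open>f\<close> and the running
  cost \<open>L\<close> are functions of the pair \<open>(x, u)\<close>.\<close>

text \<open>The usual \<open>\<epsilon>\<close>-\<open>\<delta>\<close> definition.  (The constant \<open>absolutely_continuous\<close> of the library concerns
  measures.)  Only the values of \<open>g\<close> on \<open>{a..b}\<close> matter.\<close>

definition abs_continuous_on_interval ::
    "real \<Rightarrow> real \<Rightarrow> (real \<Rightarrow> 'a::real_normed_vector) \<Rightarrow> bool" where
  "abs_continuous_on_interval a b g \<longleftrightarrow>
     (\<forall>\<epsilon>>0. \<exists>\<delta>>0. \<forall>(n::nat) (p::nat \<Rightarrow> real) (q::nat \<Rightarrow> real).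
        (\<forall>i<n. a \<le> p i \<and> p i \<le> q i \<and> q i \<le> b) \<longrightarrow>
        disjoint_family_on (\<lambda>i. {p i<..<q i}) {..<n} \<longrightarrow>
        (\<Sum>i<n. q i - p i) < \<delta> \<longrightarrow>
        (\<Sum>i<n. norm (g (q i) - g (p i))) < \<epsilon>)"

definition L2_on_interval :: "real \<Rightarrow> real \<Rightarrow> (real \<Rightarrow> 'a::euclidean_space) \<Rightarrow> bool" where
  "L2_on_interval a b u \<longleftrightarrow>
     u \<in> borel_measurable (lebesgue_on {a..b}) \<and>
     integrable (lebesgue_on {a..b}) (\<lambda>t. (norm (u t))\<^sup>2)"

definition trajectories ::
    "((real ^ 'd) \<times> (real ^ 'm) \<Rightarrow> real ^ 'd) \<Rightarrow> real \<Rightarrow> real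
      \<Rightarrow> ((real \<Rightarrow> real ^ 'd) \<times> (real \<Rightarrow> real ^ 'm)) set" where
  "trajectories f s0 s1 =
     {(\<gamma>, u). abs_continuous_on_interval s0 s1 \<gamma> \<and> L2_on_interval s0 s1 u \<and>
        (AE t in lebesgue_on {s0..s1}.
           (\<gamma> has_vector_derivative f (\<gamma> t, u t)) (at t within {s0..s1}))}"

text \<open>\<open>\<Gamma>\<^sub>s\<^sub>0\<^sub>,\<^sub>s\<^sub>1\<close> with prescribed initial point, with prescribed final point, and with both.\<close>

definition trajectories_from ::
    "((real ^ 'd) \<times> (real ^ 'm) \<Rightarrow> real ^ 'd) \<Rightarrow> real \<Rightarrow> real \<Rightarrow> real ^ 'd
      \<Rightarrow> ((real \<Rightarrow> real ^ 'd) \<times> (real \<Rightarrow> real ^ 'm)) set" where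
  "trajectories_from f s0 s1 x = {(\<gamma>, u) \<in> trajectories f s0 s1. \<gamma> s0 = x}"

definition trajectories_to ::
    "((real ^ 'd) \<times> (real ^ 'm) \<Rightarrow> real ^ 'd) \<Rightarrow> real \<Rightarrow> real \<Rightarrow> real ^ 'd
      \<Rightarrow> ((real \<Rightarrow> real ^ 'd) \<times> (real \<Rightarrow> real ^ 'm)) set" where
  "trajectories_to f s0 s1 y = {(\<gamma>, u) \<in> trajectories f s0 s1. \<gamma> s1 = y}"

definition trajectories_from_to ::
    "((real ^ 'd) \<times> (real ^ 'm) \<Rightarrow> real ^ 'd) \<Rightarrow> real \<Rightarrow> real \<Rightarrow> real ^ 'd \<Rightarrow> real ^ 'd
      \<Rightarrow> ((real \<Rightarrow> real ^ 'd) \<times> (real \<Rightarrow> real ^ 'm)) set" where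
  "trajectories_from_to f s0 s1 x y = trajectories_from f s0 s1 x \<inter> trajectories_to f s0 s1 y"

definition C2 :: "('a::real_normed_vector \<Rightarrow> 'b::real_normed_vector) \<Rightarrow> bool" where
  "C2 g \<longleftrightarrow>
     (\<exists>(g' :: 'a \<Rightarrow> 'a \<Rightarrow>\<^sub>L 'b) (g'' :: 'a \<Rightarrow> 'a \<Rightarrow>\<^sub>L 'a \<Rightarrow>\<^sub>L 'b).
        (\<forall>z. (g has_derivative blinfun_apply (g' z)) (at z)) \<and>
        (\<forall>z. (g' has_derivative blinfun_apply (g'' z)) (at z)) \<and>
        continuous_on UNIV g'')"

text \<open>The partial derivative \<open>D\<^sub>xL(x,u)\<close> as a linear form (its Euclidean norm is its \<open>onorm\<close>), and the
  partial second derivative \<open>D\<^sub>u\<^sup>2L(x,u)\<close> as a bilinear form.  These are the actual derivatives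
  whenever \<open>C2 L\<close> holds.\<close>

definition Dx :: "((real ^ 'd) \<times> (real ^ 'm) \<Rightarrow> real) \<Rightarrow> real ^ 'd \<Rightarrow> real ^ 'm \<Rightarrow> (real ^ 'd \<Rightarrow> real)" where
  "Dx L x u = frechet_derivative (\<lambda>y. L (y, u)) (at x)"

definition Du :: "((real ^ 'd) \<times> (real ^ 'm) \<Rightarrow> real) \<Rightarrow> real ^ 'd \<Rightarrow> real ^ 'm \<Rightarrow> (real ^ 'm \<Rightarrow> real)" where
  "Du L x u = frechet_derivative (\<lambda>w. L (x, w)) (at u)"

definition Duu ::
    "((real ^ 'd) \<times> (real ^ 'm) \<Rightarrow> real) \<Rightarrow> real ^ 'd \<Rightarrow> real ^ 'm
      \<Rightarrow> (real ^ 'm \<Rightarrow> real ^ 'm \<Rightarrow> real)" where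
  "Duu L x u v w = frechet_derivative (\<lambda>u'. Du L x u' w) (at u) v"

definition F0 :: "((real ^ 'd) \<times> (real ^ 'm) \<Rightarrow> real ^ 'd) \<Rightarrow> bool" where
  "F0 f \<longleftrightarrow>
     (\<exists>cf\<ge>0. \<forall>x y u.
        norm (f (x, u) - f (y, u)) \<le> cf * (1 + norm u) * norm (x - y) \<and>
        norm (f (x, u)) \<le> cf * (1 + norm u) * (1 + norm x))"

definition L1 :: "((real ^ 'd) \<times> (real ^ 'm) \<Rightarrow> real) \<Rightarrow> bool" where
  "L1 L \<longleftrightarrow>
     (\<exists>(\<beta> :: real \<Rightarrow> real) l1. mono_on {0..} \<beta> \<and> l1 > 0 \<and>
        (\<forall>x u. L (x, u) \<le> \<beta> (norm x) * (1 + (norm u)\<^sup>2) \<and>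
               onorm (Dx L x u) \<le> l1 * (1 + (norm u)\<^sup>2) \<and>
               (\<forall>v. Duu L x u v v \<ge> 1 / l1 * (norm v)\<^sup>2)))"

definition L2 :: "((real ^ 'd) \<times> (real ^ 'm) \<Rightarrow> real) \<Rightarrow> real ^ 'm \<Rightarrow> bool" where
  "L2 L us \<longleftrightarrow> (\<forall>x u. L (x, u) \<ge> L (x, us))"

text \<open>The infimum over the complement of \<open>K\<close> is taken in the extended reals.  The minimum over \<open>K\<close> is
  written as the value at a minimiser; a minimiser is required to exist, at which moreover \<open>f\<close> vanishes.\<close>

definition L3 ::
    "((real ^ 'd) \<times> (real ^ 'm) \<Rightarrow> real ^ 'd) \<Rightarrow> ((real ^ 'd) \<times> (real ^ 'm) \<Rightarrow> real) \<Rightarrow> real ^ 'm \<Rightarrow> bool" where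
  "L3 f L us \<longleftrightarrow>
     (\<exists>K \<Theta> xs. compact K \<and> \<Theta> > 0 \<and>
        is_arg_min (\<lambda>x. L (x, us)) (\<lambda>x. x \<in> K) xs \<and> f (xs, us) = 0 \<and>
        (\<forall>u. (INF x\<in>-K. ereal (L (x, u))) \<ge> ereal (\<Theta> + L (xs, us))))"

definition LUGC :: "((real ^ 'd) \<times> (real ^ 'm) \<Rightarrow> real ^ 'd) \<Rightarrow> bool" where
  "LUGC f \<longleftrightarrow>
     (\<forall>R\<ge>0. \<exists>T\<ge>0. \<exists>C\<ge>0. \<forall>x\<in>cball 0 R. \<forall>y\<in>cball 0 R.
        \<exists>(\<gamma>, u)\<in>trajectories_from_to f 0 T x y.
          (LINT s|lebesgue_on {0..T}. (norm (u s))\<^sup>2) \<le> C)"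

text \<open>The infimum is a real one: under the hypotheses above the set is nonempty, the integrands are
  integrable and \<open>L\<close> is bounded below.\<close>

definition value_fun ::
    "((real ^ 'd) \<times> (real ^ 'm) \<Rightarrow> real ^ 'd) \<Rightarrow> ((real ^ 'd) \<times> (real ^ 'm) \<Rightarrow> real)
      \<Rightarrow> real \<Rightarrow> real ^ 'd \<Rightarrow> real" where
  "value_fun f L T x =
     (INF (\<gamma>, u)\<in>trajectories_from f 0 T x. LINT s|lebesgue_on {0..T}. L (\<gamma> s, u s))"

end

theory Submission
  imports Defs
begin

text \<open>
  The critical constant is the running cost of resting at the equilibrium, \<open>\<alpha> = L (xs, us)\<close>, where
  \<open>xs\<close> and \<open>K\<close> are the point and the compact set provided by \<open>L3\<close>.  Inside \<open>K\<close> the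
  control \<open>us\<close> is the cheapest one and \<open>xs\<close> the cheapest point for it; outside \<open>K\<close> every running
  cost exceeds \<open>\<alpha>\<close>.  So \<open>L \<ge> \<alpha>\<close> everywhere, and \<open>V\<^sub>T \<ge> \<alpha> T\<close>.  On the other hand \<open>f (xs, us) = 0\<close>:
  from any \<open>x\<close> in a ball one can steer to \<open>xs\<close> within a time and with a control energy that depend
  only on the ball, and stay there at the price \<open>\<alpha>\<close> per unit of time
  (\<open>trajectory_stop_at_equilibrium\<close>).  Hence \<open>\<alpha> T \<le> V\<^sub>T(x) \<le> \<alpha> T + C\<close> on the ball, for all large \<open>T\<close>
  (\<open>value_fun_bounds\<close>), and dividing by \<open>T\<close> gives the limit.

  The constant \<open>C\<close> must not depend on \<open>x\<close>.  As \<open>L (x, u)\<close> is only controlled by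
  \<open>\<beta> (norm x)\<close>, this requires a bound on the steering trajectories that is uniform in their starting
  points.  It comes from a Gronwall estimate for \<open>ln (1 + norm (\<gamma> t)\<^sup>2)\<close>
  (\<open>trajectory_log_energy_le\<close>): by the linear growth of \<open>f\<close> the derivative of this function is at most
  a multiple of \<open>2 + norm (u t)\<^sup>2\<close>, independently of \<open>\<gamma>\<close>.  Trajectories are differentiable only
  almost everywhere, so integrating that inequality uses the fundamental theorem of calculus for
  absolutely continuous functions (\<open>fundamental_theorem_of_calculus_abs_continuous\<close>).
\<close>

section \<open>Absolutely continuous functions\<close>

text \<open>In Riemann sums the intervals are indexed by a tagged division rather than by an initial segment
  of the natural numbers; here the index type is arbitrary.\<close>

lemma abs_continuous_on_interval_finite_family:
  fixes g :: "real \<Rightarrow> 'a::real_normed_vector"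
  assumes "abs_continuous_on_interval a b g" "\<epsilon> > 0"
  shows "\<exists>\<delta>>0. \<forall>(I :: 'i set) p q. finite I \<longrightarrow> (\<forall>i\<in>I. a \<le> p i \<and> p i \<le> q i \<and> q i \<le> b) \<longrightarrow>
       disjoint_family_on (\<lambda>i. {p i<..<q i}) I \<longrightarrow> (\<Sum>i\<in>I. q i - p i) < \<delta> \<longrightarrow>
       (\<Sum>i\<in>I. norm (g (q i) - g (p i))) < \<epsilon>"
proof -
  obtain \<delta> where "\<delta> > 0" and \<delta>:
    "\<forall>(n::nat) p q. (\<forall>i<n. a \<le> p i \<and> p i \<le> q i \<and> q i \<le> b) \<longrightarrow>
        disjoint_family_on (\<lambda>i. {p i<..<q i}) {..<n} \<longrightarrow>
        (\<Sum>i<n. q i - p i) < \<delta> \<longrightarrow> (\<Sum>i<n. norm (g (q i) - g (p i))) < \<epsilon>"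
    using assms(1)[unfolded abs_continuous_on_interval_def, THEN spec, THEN mp, OF assms(2)]
    by (elim exE conjE) (rule that; assumption)
  have "(\<Sum>i\<in>I. norm (g (q i) - g (p i))) < \<epsilon>"
    if "finite I" and pq: "\<forall>i\<in>I. a \<le> p i \<and> p i \<le> q i \<and> q i \<le> b"
      and disj: "disjoint_family_on (\<lambda>i. {p i<..<q i}) I" and less: "(\<Sum>i\<in>I. q i - p i) < \<delta>"
    for I :: "'i set" and p q
  proof -
    obtain h where h: "bij_betw h {0..<card I} I"
      using ex_bij_betw_nat_finite[OF \<open>finite I\<close>] by blast
    then have h': "bij_betw h {..<card I} I"
      by (simp add: lessThan_atLeast0)
    have "(\<Sum>i<card I. norm (g (q (h i)) - g (p (h i)))) < \<epsilon>"
    proof (rule \<delta>[THEN spec, THEN spec, THEN spec, THEN mp, THEN mp, THEN mp])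
      show "\<forall>i<card I. a \<le> p (h i) \<and> p (h i) \<le> q (h i) \<and> q (h i) \<le> b"
        using pq bij_betwE[OF h'] by auto
      show "disjoint_family_on (\<lambda>i. {p (h i)<..<q (h i)}) {..<card I}"
        using disj bij_betwE[OF h'] bij_betw_imp_inj_on[OF h']
        unfolding disjoint_family_on_def inj_on_def by metis
      show "(\<Sum>i<card I. q (h i) - p (h i)) < \<delta>"
        using less sum.reindex_bij_betw[OF h', of "\<lambda>i. q i - p i"] by simp
    qed
    then show ?thesis
      using sum.reindex_bij_betw[OF h', of "\<lambda>i. norm (g (q i) - g (p i))"] by simp
  qed
  then show ?thesis
    by (intro exI[of _ \<delta>] conjI[OF \<open>\<delta> > 0\<close>] allI impI) simp
qed

lemma abs_continuous_on_interval_imp_continuous_on: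
  assumes "abs_continuous_on_interval a b g"
  shows "continuous_on {a..b} g"
  unfolding continuous_on_iff
proof (intro ballI allI impI)
  fix x and e :: real
  assume x: "x \<in> {a..b}" and "e > 0"
  obtain \<delta> where "\<delta> > 0" and \<delta>:
    "\<forall>I p q. finite I \<longrightarrow> (\<forall>i\<in>I. a \<le> p i \<and> p i \<le> q i \<and> q i \<le> b) \<longrightarrow>
       disjoint_family_on (\<lambda>i::unit. {p i<..<q i}) I \<longrightarrow> (\<Sum>i\<in>I. q i - p i) < \<delta> \<longrightarrow>
       (\<Sum>i\<in>I. norm (g (q i) - g (p i))) < e"
    using abs_continuous_on_interval_finite_family[OF assms \<open>e > 0\<close>]
    by (elim exE conjE) (rule that; assumption)
  have "dist (g y) (g x) < e" if y: "y \<in> {a..b}" "dist y x < \<delta>" for y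
  proof -
    have "norm (g (max x y) - g (min x y)) < e"
      using \<delta>[rule_format, of "{()}" "\<lambda>_. min x y" "\<lambda>_. max x y"] x y
      by (auto simp: disjoint_family_on_def dist_real_def)
    then show ?thesis
      by (cases "x \<le> y") (auto simp: dist_norm norm_minus_commute max_def min_def)
  qed
  with \<open>\<delta> > 0\<close> show "\<exists>d>0. \<forall>y\<in>{a..b}. dist y x < d \<longrightarrow> dist (g y) (g x) < e" by blast
qed

text \<open>Set the derivative to \<open>0\<close> on the exceptional null set \<open>N\<close> and compare the increment of \<open>g\<close> with
  the Riemann sum of a fine tagged division.  At a tag outside \<open>N\<close> differentiability makes the error a
  small multiple of the length of the interval.  The intervals with tags in \<open>N\<close> contribute nothing to
  the Riemann sum; the gauge forces them into an open set of small measure, so their total length is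
  small and absolute continuity makes the corresponding increments of \<open>g\<close> small.\<close>

lemma fundamental_theorem_of_calculus_abs_continuous:
  fixes g :: "real \<Rightarrow> 'a::euclidean_space"
  assumes "a \<le> b" and ac: "abs_continuous_on_interval a b g"
    and N: "negligible N"
    and der: "\<And>t. t \<in> {a..b} - N \<Longrightarrow> (g has_vector_derivative g' t) (at t within {a..b})"
  shows "(g' has_integral (g b - g a)) {a..b}"
proof -
  define h where "h t = (if t \<in> N then 0 else g' t)" for t
  have "(h has_integral (g b - g a)) (cbox a b)"
    unfolding has_integral
  proof (intro allI impI)
    fix e :: real assume "e > 0"
    define \<eta> where "\<eta> = e / (2 * (b - a + 1))"
    have "\<eta> > 0" using \<open>e > 0\<close> \<open>a \<le> b\<close> by (simp add: \<eta>_def)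
    have \<eta>: "\<eta> * (b - a) \<le> e / 2"
      using \<open>e > 0\<close> \<open>a \<le> b\<close> by (simp add: \<eta>_def field_simps)
    obtain \<delta> where "\<delta> > 0" and \<delta>:
      "\<forall>I p q. finite I \<longrightarrow> (\<forall>i\<in>I. a \<le> p i \<and> p i \<le> q i \<and> q i \<le> b) \<longrightarrow>
         disjoint_family_on (\<lambda>i::real \<times> real set. {p i<..<q i}) I \<longrightarrow> (\<Sum>i\<in>I. q i - p i) < \<delta> \<longrightarrow>
         (\<Sum>i\<in>I. norm (g (q i) - g (p i))) < e / 2"
      using abs_continuous_on_interval_finite_family[OF ac half_gt_zero[OF \<open>e > 0\<close>]]
      by (elim exE conjE) (rule that; assumption)
    have "N \<in> sets lebesgue"
      using N by (simp add: negligible_iff_null_sets null_setsD2)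
    then obtain U where U: "open U" "N \<subseteq> U" "U - N \<in> lmeasurable" "emeasure lebesgue (U - N) < \<delta>"
      using sets_lebesgue_outer_open[of N \<delta>] \<open>\<delta> > 0\<close> by blast
    have NN: "N \<in> lmeasurable" "measure lebesgue N = 0"
      using N negligible_iff_measure by auto
    have UL: "U \<in> lmeasurable"
      using fmeasurable.Un[OF U(3) NN(1)] U(2) by (simp add: Un_absorb2)
    have Um: "measure lebesgue U < \<delta>"
    proof -
      have "measure lebesgue U = measure lebesgue (U - N)"
        using UL NN U(2) by (simp add: measurable_measure_Diff fmeasurableD)
      also have "\<dots> < \<delta>"
        using U(3,4) \<open>\<delta> > 0\<close> by (simp add: emeasure_eq_measure2 ennreal_less_iff)
      finally show ?thesis .
    qed
    have "\<forall>x. \<exists>d>0. x \<in> {a..b} - N \<longrightarrow>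
         (\<forall>y\<in>{a..b}. norm (y-x) < d \<longrightarrow> norm (g y - g x - (y-x) *\<^sub>R g' x) \<le> \<eta> * norm (y-x))"
    proof
      fix x
      show "\<exists>d>0. x \<in> {a..b} - N \<longrightarrow>
         (\<forall>y\<in>{a..b}. norm (y-x) < d \<longrightarrow> norm (g y - g x - (y-x) *\<^sub>R g' x) \<le> \<eta> * norm (y-x))"
      proof (cases "x \<in> {a..b} - N")
        case True
        then show ?thesis
          using der[OF True, unfolded has_vector_derivative_def has_derivative_within_alt] \<open>\<eta> > 0\<close>
          by blast
      qed (auto intro: exI[of _ 1])
    qed
    then obtain d where d: "\<And>x. 0 < d x"
      "\<And>x y. \<lbrakk>x \<in> {a..b} - N; y \<in> {a..b}; norm (y-x) < d x\<rbrakk>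
           \<Longrightarrow> norm (g y - g x - (y-x) *\<^sub>R g' x) \<le> \<eta> * norm (y-x)"
      by metis
    define G where "G x = (if x \<in> N then U else ball x (d x))" for x
    have "gauge G"
      using U d(1) by (auto simp: gauge_def G_def)
    have main: "norm ((\<Sum>(x,K)\<in>\<D>. measure lborel K *\<^sub>R h x) - (g b - g a)) < e"
      if D: "\<D> tagged_division_of cbox a b" and fine: "G fine \<D>" for \<D>
    proof -
      \<comment> \<open>\<open>E\<close> is the error of a single interval, \<open>P\<close> collects the intervals tagged in \<open>N\<close>.\<close>
      define E where "E = (\<lambda>(x::real,K). measure lborel K *\<^sub>R h x - (g (Sup K) - g (Inf K)))"
      define P where "P = {i \<in> \<D>. fst i \<in> N}"
      note Dfacts = tagged_division_ofD[OF D]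
      have K: "Inf K \<le> x" "x \<le> Sup K" "interior K = {Inf K<..<Sup K}" "a \<le> Inf K" "Sup K \<le> b"
        "measure lborel K = Sup K - Inf K" "Inf K \<in> K" "Sup K \<in> K" if xK: "(x, K) \<in> \<D>" for x K
      proof -
        obtain u v where uv: "K = {u..v}" using Dfacts(4)[OF xK] by auto
        have "x \<in> K" "K \<subseteq> {a..b}" using Dfacts(2,3)[OF xK] by auto
        then have "u \<le> v" "Inf K = u" "Sup K = v" using uv by auto
        with uv \<open>x \<in> K\<close> \<open>K \<subseteq> {a..b}\<close>
        show "Inf K \<le> x" "x \<le> Sup K" "interior K = {Inf K<..<Sup K}" "a \<le> Inf K" "Sup K \<le> b"
          "measure lborel K = Sup K - Inf K" "Inf K \<in> K" "Sup K \<in> K"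
          by auto
      qed
      have finP: "finite P" "P \<subseteq> \<D>" using Dfacts(1) by (auto simp: P_def)
      have tele: "b - a = (\<Sum>(x,K)\<in>\<D>. Sup K - Inf K)" "g b - g a = (\<Sum>(x,K)\<in>\<D>. g(Sup K) - g(Inf K))"
        using additive_tagged_division_1[where f= "\<lambda>x. x"] additive_tagged_division_1[where f= g]
            \<open>a \<le> b\<close> D by auto
      have "(\<Sum>(x,K)\<in>\<D>. measure lborel K *\<^sub>R h x) - (g b - g a) = (\<Sum>i\<in>\<D>. E i)"
        unfolding tele E_def sum_subtractf[symmetric] by (rule sum.cong) auto
      also have "\<dots> = (\<Sum>i\<in>P. E i) + (\<Sum>i\<in>\<D> - P. E i)"
        using sum.subset_diff[OF finP(2) Dfacts(1), of E] by (simp add: add.commute)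
      finally have split: "(\<Sum>(x,K)\<in>\<D>. measure lborel K *\<^sub>R h x) - (g b - g a)
          = (\<Sum>i\<in>P. E i) + (\<Sum>i\<in>\<D> - P. E i)" .
      have disj: "disjoint_family_on (\<lambda>i. {Inf (snd i)<..<Sup (snd i)}) P"
        unfolding disjoint_family_on_def
      proof (intro ballI impI)
        fix i j assume ij: "i \<in> P" "j \<in> P" "i \<noteq> j"
        then have mem: "(fst i, snd i) \<in> \<D>" "(fst j, snd j) \<in> \<D>" using finP by auto
        have "interior (snd i) \<inter> interior (snd j) = {}"
          using Dfacts(5)[OF mem] ij(3) by (simp add: prod_eq_iff)
        moreover have "interior (snd i) = {Inf (snd i)<..<Sup (snd i)}" "interior (snd j) = {Inf (snd j)<..<Sup (snd j)}"
          using K(3)[OF mem(1)] K(3)[OF mem(2)] .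
        ultimately show "{Inf (snd i)<..<Sup (snd i)} \<inter> {Inf (snd j)<..<Sup (snd j)} = {}"
          by simp
      qed
      have fin_meas: "emeasure lborel {u<..<v} \<noteq> top" for u v :: real
        using emeasure_lborel_box_finite[of u v] by (simp add: box_real less_top)
      have "(\<Sum>i\<in>P. Sup (snd i) - Inf (snd i)) = (\<Sum>i\<in>P. measure lebesgue {Inf (snd i)<..<Sup (snd i)})"
      proof (rule sum.cong[OF refl])
        fix i assume "i \<in> P"
        then have "Inf (snd i) \<le> Sup (snd i)"
          using K(1,2)[of "fst i" "snd i"] finP(2) by auto
        then show "Sup (snd i) - Inf (snd i) = measure lebesgue {Inf (snd i)<..<Sup (snd i)}"
          by simp
      qed
      also have "\<dots> = measure lebesgue (\<Union>i\<in>P. {Inf (snd i)<..<Sup (snd i)})"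
        by (rule measure_finite_Union[symmetric]) (use finP disj fin_meas in auto)
      also have "\<dots> \<le> measure lebesgue U"
      proof (rule measure_mono_fmeasurable[OF _ _ UL])
        show "(\<Union>i\<in>P. {Inf (snd i)<..<Sup (snd i)}) \<subseteq> U"
        proof safe
          fix x K y assume xK: "(x, K) \<in> P" and y: "y \<in> {Inf (snd (x,K))<..<Sup (snd (x,K))}"
          then have "K \<subseteq> G x" "x \<in> N" using fine by (auto simp: P_def fine_def)
          moreover have "y \<in> interior K" using K(3)[of x K] xK finP(2) y by auto
          then have "y \<in> K" using interior_subset by blast
          ultimately show "y \<in> U" by (auto simp: G_def)
        qed
      qed (use finP in auto)
      finally have small: "(\<Sum>i\<in>P. Sup (snd i) - Inf (snd i)) < \<delta>" using Um by simp
      have "norm (\<Sum>i\<in>P. E i) \<le> (\<Sum>i\<in>P. norm (g (Sup (snd i)) - g (Inf (snd i))))"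
        by (rule sum_norm_le) (auto simp: P_def E_def h_def norm_minus_commute)
      also have "\<dots> < e / 2"
      proof (rule \<delta>[rule_format, OF finP(1) _ disj small])
        fix i assume "i \<in> P"
        then show "a \<le> Inf (snd i) \<and> Inf (snd i) \<le> Sup (snd i) \<and> Sup (snd i) \<le> b"
          using K(1,2,4,5)[of "fst i" "snd i"] finP(2) by auto
      qed
      finally have bad: "norm (\<Sum>i\<in>P. E i) < e / 2" .
      have "norm (\<Sum>i\<in>\<D> - P. E i) \<le> (\<Sum>i\<in>\<D> - P. \<eta> * (Sup (snd i) - Inf (snd i)))"
      proof (rule sum_norm_le)
        fix i assume "i \<in> \<D> - P"
        then obtain x K where i: "i = (x, K)" "(x, K) \<in> \<D>" "x \<notin> N" by (cases i) (auto simp: P_def)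
        note k = K[OF i(2)]
        have xab: "x \<in> {a..b} - N" using k(1,2,4,5) i(3) by simp
        have sub: "K \<subseteq> ball x (d x)" using fineD[OF fine i(2)] i(3) by (simp add: G_def)
        then have "Inf K \<in> ball x (d x)" "Sup K \<in> ball x (d x)" using k(7,8) by blast+
        then have near: "norm (Inf K - x) < d x" "norm (Sup K - x) < d x"
          by (simp_all add: dist_norm norm_minus_commute)
        have 1: "norm (g (Inf K) - g x - (Inf K - x) *\<^sub>R g' x) \<le> \<eta> * norm (Inf K - x)"
          by (rule d(2)[OF xab _ near(1)]) (use k(1,2,4,5) in simp)
        have 2: "norm (g (Sup K) - g x - (Sup K - x) *\<^sub>R g' x) \<le> \<eta> * norm (Sup K - x)"
          by (rule d(2)[OF xab _ near(2)]) (use k(1,2,4,5) in simp)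
        have "E i = (g (Inf K) - g x - (Inf K - x) *\<^sub>R g' x) - (g (Sup K) - g x - (Sup K - x) *\<^sub>R g' x)"
          unfolding E_def i(1) prod.case k(6) using i(3) by (simp add: h_def algebra_simps)
        then have "norm (E i) \<le> \<eta> * norm (Inf K - x) + \<eta> * norm (Sup K - x)"
          using norm_triangle_ineq4[of "g (Inf K) - g x - (Inf K - x) *\<^sub>R g' x" "g (Sup K) - g x - (Sup K - x) *\<^sub>R g' x"] 1 2
          by simp
        also have "\<dots> = \<eta> * (Sup K - Inf K)"
          using k(1,2) by (simp add: algebra_simps)
        finally show "norm (E i) \<le> \<eta> * (Sup (snd i) - Inf (snd i))" using i by simp
      qed
      also have "\<dots> \<le> (\<Sum>i\<in>\<D>. \<eta> * (Sup (snd i) - Inf (snd i)))"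
      proof (rule sum_mono2[OF Dfacts(1)])
        fix i assume "i \<in> \<D> - (\<D> - P)"
        then show "0 \<le> \<eta> * (Sup (snd i) - Inf (snd i))"
          using K(1,2)[of "fst i" "snd i"] \<open>\<eta> > 0\<close> by auto
      qed auto
      also have "\<dots> = \<eta> * (b - a)"
        unfolding tele sum_distrib_left by (rule sum.cong) auto
      finally have good: "norm (\<Sum>i\<in>\<D> - P. E i) \<le> e / 2" using \<eta> by simp
      show ?thesis
        unfolding split using norm_triangle_ineq[of "\<Sum>i\<in>P. E i" "\<Sum>i\<in>\<D> - P. E i"] bad good by linarith
    qed
    show "\<exists>\<gamma>. gauge \<gamma> \<and> (\<forall>\<D>. \<D> tagged_division_of cbox a b \<and> \<gamma> fine \<D> \<longrightarrow>
        norm ((\<Sum>(x,K)\<in>\<D>. measure lborel K *\<^sub>R h x) - (g b - g a)) < e)"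
    proof (intro exI[of _ G] conjI allI impI)
      show "gauge G" by fact
    next
      fix \<D> assume "\<D> tagged_division_of cbox a b \<and> G fine \<D>"
      then show "norm ((\<Sum>(x,K)\<in>\<D>. measure lborel K *\<^sub>R h x) - (g b - g a)) < e"
        by (elim conjE) (rule main)
    qed
  qed
  then have "(h has_integral (g b - g a)) {a..b}" by simp
  then show ?thesis
    by (rule has_integral_spike[OF N, rotated]) (simp add: h_def)
qed

text \<open>Composition with a Lipschitz map (\<open>r\<close> the identity), restriction to a subinterval (again \<open>r\<close> the
  identity) and stopping at a time \<open>a\<close> (\<open>r t = min t a\<close>) are all of this form: a monotone reparametrisation
  that does not stretch keeps disjoint short intervals disjoint and short.\<close>

lemma abs_continuous_on_interval_transfer:
  assumes g: "abs_continuous_on_interval a b g"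
    and r: "\<And>s t. a' \<le> s \<Longrightarrow> s \<le> t \<Longrightarrow> t \<le> b' \<Longrightarrow>
              a \<le> r s \<and> r s \<le> r t \<and> r t \<le> b \<and> r t - r s \<le> t - s"
    and C: "C > 0"
    and h: "\<And>s t. a' \<le> s \<Longrightarrow> s \<le> t \<Longrightarrow> t \<le> b' \<Longrightarrow> norm (h t - h s) \<le> C * norm (g (r t) - g (r s))"
  shows "abs_continuous_on_interval a' b' h"
  unfolding abs_continuous_on_interval_def
proof (intro allI impI)
  fix \<epsilon> :: real assume "\<epsilon> > 0"
  with C have "\<epsilon> / C > 0" by simp
  obtain \<delta> where "\<delta> > 0" and \<delta>:
    "\<forall>(n::nat) p q. (\<forall>i<n. a \<le> p i \<and> p i \<le> q i \<and> q i \<le> b) \<longrightarrow>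
        disjoint_family_on (\<lambda>i. {p i<..<q i}) {..<n} \<longrightarrow>
        (\<Sum>i<n. q i - p i) < \<delta> \<longrightarrow> (\<Sum>i<n. norm (g (q i) - g (p i))) < \<epsilon> / C"
    using g[unfolded abs_continuous_on_interval_def, THEN spec, THEN mp, OF \<open>\<epsilon> / C > 0\<close>]
    by (elim exE conjE) (rule that; assumption)
  have "(\<Sum>i<n. norm (h (q i) - h (p i))) < \<epsilon>"
    if pq: "\<forall>i<n. a' \<le> p i \<and> p i \<le> q i \<and> q i \<le> b'"
      and disj: "disjoint_family_on (\<lambda>i. {p i<..<q i}) {..<n}" and less: "(\<Sum>i<n. q i - p i) < \<delta>"
    for n :: nat and p q
  proof -
    have "(\<Sum>i<n. norm (g (r (q i)) - g (r (p i)))) < \<epsilon> / C"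
    proof (rule \<delta>[THEN spec, THEN spec, THEN spec, THEN mp, THEN mp, THEN mp])
      show "\<forall>i<n. a \<le> r (p i) \<and> r (p i) \<le> r (q i) \<and> r (q i) \<le> b"
        using pq r by blast
      show "disjoint_family_on (\<lambda>i. {r (p i)<..<r (q i)}) {..<n}"
        unfolding disjoint_family_on_def
      proof (intro ballI impI equals0I)
        fix i j y assume ij: "i \<in> {..<n}" "j \<in> {..<n}" "i \<noteq> j"
          and y: "y \<in> {r (p i)<..<r (q i)} \<inter> {r (p j)<..<r (q j)}"
        have lt: "p k < q l" if "k \<in> {i, j}" "l \<in> {i, j}" for k l
        proof (rule ccontr)
          assume "\<not> p k < q l"
          then have "r (q l) \<le> r (p k)"
            using r[of "q l" "p k"] pq ij that by fastforce
          with y that show False by auto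
        qed
        obtain z where "max (p i) (p j) < z" "z < min (q i) (q j)"
          using dense[of "max (p i) (p j)" "min (q i) (q j)"] lt by auto
        then have "z \<in> {p i<..<q i} \<inter> {p j<..<q j}" by auto
        with disj ij show False unfolding disjoint_family_on_def by blast
      qed
      have "(\<Sum>i<n. r (q i) - r (p i)) \<le> (\<Sum>i<n. q i - p i)"
        using pq r by (intro sum_mono) blast
      with less show "(\<Sum>i<n. r (q i) - r (p i)) < \<delta>" by simp
    qed
    then have "C * (\<Sum>i<n. norm (g (r (q i)) - g (r (p i)))) < \<epsilon>"
      using C by (simp add: field_simps)
    moreover have "(\<Sum>i<n. norm (h (q i) - h (p i))) \<le> C * (\<Sum>i<n. norm (g (r (q i)) - g (r (p i))))"
      unfolding sum_distrib_left using pq h by (intro sum_mono) blast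
    ultimately show ?thesis by simp
  qed
  then show "\<exists>\<delta>>0. \<forall>(n::nat) p q. (\<forall>i<n. a' \<le> p i \<and> p i \<le> q i \<and> q i \<le> b') \<longrightarrow>
        disjoint_family_on (\<lambda>i. {p i<..<q i}) {..<n} \<longrightarrow>
        (\<Sum>i<n. q i - p i) < \<delta> \<longrightarrow> (\<Sum>i<n. norm (h (q i) - h (p i))) < \<epsilon>"
    by (intro exI[of _ \<delta>] conjI[OF \<open>\<delta> > 0\<close>]) simp
qed

section \<open>An a priori bound for trajectories\<close>

lemma has_derivative_log_energy:
  fixes x :: "'a::euclidean_space"
  shows "((\<lambda>x. ln (1 + x \<bullet> x)) has_derivative (\<lambda>h. 2 * (x \<bullet> h) / (1 + x \<bullet> x))) (at x within S)"
proof -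
  have "1 + x \<bullet> x > 0" by (simp add: add_pos_nonneg)
  then show ?thesis
    by (auto intro!: derivative_eq_intros simp: inner_commute divide_simps)
qed

text \<open>The gradient \<open>2 x / (1 + norm x\<^sup>2)\<close> has norm at most \<open>1\<close>.  The global Lipschitz bound keeps
  the composition with an absolutely continuous curve absolutely continuous.\<close>

lemma lipschitz_log_energy: "1-lipschitz_on UNIV (\<lambda>x::'a::euclidean_space. ln (1 + x \<bullet> x))"
proof (rule lipschitz_onI)
  fix x y :: 'a
  have "norm (ln (1 + x \<bullet> x) - ln (1 + y \<bullet> y)) \<le> 1 * norm (x - y)"
  proof (rule differentiable_bound[OF convex_UNIV has_derivative_log_energy])
    fix z :: 'a
    have pos: "1 + z \<bullet> z > 0" by (simp add: add_pos_nonneg)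
    show "onorm (\<lambda>h. 2 * (z \<bullet> h) / (1 + z \<bullet> z)) \<le> 1"
    proof (rule onorm_bound)
      fix h
      have "\<bar>2 * (z \<bullet> h)\<bar> \<le> (2 * norm z) * norm h"
        using Cauchy_Schwarz_ineq2[of z h] by (simp add: abs_mult)
      also have "\<dots> \<le> (1 + z \<bullet> z) * norm h"
        using sum_power2_ge_zero[of "norm z - 1" 0]
        by (intro mult_right_mono) (auto simp: power2_norm_eq_inner[symmetric] power2_eq_square algebra_simps)
      finally show "norm (2 * (z \<bullet> h) / (1 + z \<bullet> z)) \<le> 1 * norm h"
        using pos by (simp add: divide_simps mult.commute abs_mult)
    qed simp
  qed auto
  then show "dist (ln (1 + x \<bullet> x)) (ln (1 + y \<bullet> y)) \<le> 1 * dist x y" by (simp add: dist_norm)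
qed simp

text \<open>Gronwall's inequality in logarithmic form.  Along a trajectory the derivative of
  \<open>ln (1 + norm \<gamma>\<^sup>2)\<close> is at most \<open>2 cf (1 + norm u) norm \<gamma> (1 + norm \<gamma>) / (1 + norm \<gamma>\<^sup>2)\<close>; the quotient in
  \<open>\<gamma>\<close> is at most \<open>2\<close>, and \<open>1 + norm u \<le> 2 + norm u\<^sup>2\<close> trades the control for its energy.\<close>

lemma trajectory_log_energy_le:
  fixes f :: "(real ^ 'd) \<times> (real ^ 'm) \<Rightarrow> real ^ 'd"
  assumes growth: "\<And>x u. norm (f (x, u)) \<le> cf * (1 + norm u) * (1 + norm x)" and "cf \<ge> 0"
    and tr: "(\<gamma>, u) \<in> trajectories f 0 T" and t: "t \<in> {0..T}"
  shows "ln (1 + \<gamma> t \<bullet> \<gamma> t) \<le> ln (1 + \<gamma> 0 \<bullet> \<gamma> 0)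
           + 4 * cf * (2 * T + (LINT s|lebesgue_on {0..T}. (norm (u s))\<^sup>2))"
proof -
  have ac: "abs_continuous_on_interval 0 T \<gamma>"
    and u2: "integrable (lebesgue_on {0..T}) (\<lambda>t. (norm (u t))\<^sup>2)"
    and der: "AE t in lebesgue_on {0..T}. (\<gamma> has_vector_derivative f (\<gamma> t, u t)) (at t within {0..T})"
    using tr by (auto simp: trajectories_def L2_on_interval_def)
  define D where "D s = 2 * (\<gamma> s \<bullet> f (\<gamma> s, u s)) / (1 + \<gamma> s \<bullet> \<gamma> s)" for s
  define H where "H s = 4 * cf * (2 + (norm (u s))\<^sup>2)" for s
  obtain N where "N \<in> null_sets (lebesgue_on {0..T})"
    and N: "{s \<in> space (lebesgue_on {0..T}). \<not> (\<gamma> has_vector_derivative f (\<gamma> s, u s)) (at s within {0..T})} \<subseteq> N"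
    using der by (auto simp: eventually_ae_filter)
  then have "negligible N"
    by (simp add: negligible_iff_null_sets null_sets_restrict_space)
  have "(D has_integral (ln (1 + \<gamma> t \<bullet> \<gamma> t) - ln (1 + \<gamma> 0 \<bullet> \<gamma> 0))) {0..t}"
  proof (rule fundamental_theorem_of_calculus_abs_continuous[OF _ _ \<open>negligible N\<close>])
    show "abs_continuous_on_interval 0 t (\<lambda>s. ln (1 + \<gamma> s \<bullet> \<gamma> s))"
      using lipschitz_onD[OF lipschitz_log_energy] t
      by (intro abs_continuous_on_interval_transfer[OF ac, where r = "\<lambda>s. s" and C = 1])
        (auto simp: dist_norm)
    fix s assume s: "s \<in> {0..t} - N"
    then have "(\<gamma> has_vector_derivative f (\<gamma> s, u s)) (at s within {0..T})"
      using N t by auto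
    then have "(\<gamma> has_vector_derivative f (\<gamma> s, u s)) (at s within {0..t})"
      by (rule has_vector_derivative_within_subset) (use t in auto)
    from has_derivative_compose[OF this[unfolded has_vector_derivative_def] has_derivative_log_energy[of _ UNIV]]
    show "((\<lambda>s. ln (1 + \<gamma> s \<bullet> \<gamma> s)) has_vector_derivative D s) (at s within {0..t})"
      by (simp add: has_vector_derivative_def D_def algebra_simps)
  qed (use t in auto)
  moreover have Hint: "integrable (lebesgue_on {0..T}) H"
    unfolding H_def using u2 by (auto simp: integrable_const_ivl)
  then have HT: "(H has_integral (LINT s|lebesgue_on {0..T}. H s)) {0..T}"
    by (rule has_integral_integral_lebesgue_on) simp
  have Ht: "H integrable_on {0..t}"
    by (rule integrable_on_subinterval[OF has_integral_integrable[OF HT]]) (use t in auto)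
  then have "(H has_integral integral {0..t} H) {0..t}" by (rule integrable_integral)
  moreover have "D s \<le> H s" if "s \<in> {0..t}" for s
  proof -
    let ?r = "norm (\<gamma> s)" and ?v = "norm (u s)"
    have pos: "1 + \<gamma> s \<bullet> \<gamma> s > 0" by (simp add: add_pos_nonneg)
    have square: "r \<le> 1 + r\<^sup>2" for r :: real
    proof -
      have "r\<^sup>2 - r + 1 / 4 = (r - 1 / 2)\<^sup>2" by (simp add: power2_diff power_divide)
      then have "r\<^sup>2 - r + 1 / 4 \<ge> 0" by simp
      then show ?thesis by linarith
    qed
    have r: "?r * (1 + ?r) \<le> 2 * (1 + \<gamma> s \<bullet> \<gamma> s)"
      using square[of ?r] by (simp add: power2_norm_eq_inner[symmetric] power2_eq_square distrib_left)
    have v: "1 + ?v \<le> 2 + ?v\<^sup>2"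
      using square[of ?v] by simp
    have "\<gamma> s \<bullet> f (\<gamma> s, u s) \<le> ?r * norm (f (\<gamma> s, u s))"
      by (rule norm_cauchy_schwarz)
    also have "\<dots> \<le> ?r * (cf * (1 + ?v) * (1 + ?r))"
      by (rule mult_left_mono[OF growth]) simp
    also have "\<dots> = cf * (1 + ?v) * (?r * (1 + ?r))" by simp
    also have "\<dots> \<le> cf * (2 + ?v\<^sup>2) * (2 * (1 + \<gamma> s \<bullet> \<gamma> s))"
      by (rule mult_mono[OF mult_left_mono[OF v \<open>cf \<ge> 0\<close>] r]) (use \<open>cf \<ge> 0\<close> in simp_all)
    finally have "2 * (\<gamma> s \<bullet> f (\<gamma> s, u s)) \<le> 2 * (cf * (2 + ?v\<^sup>2) * (2 * (1 + \<gamma> s \<bullet> \<gamma> s)))"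
      by simp
    also have "\<dots> = H s * (1 + \<gamma> s \<bullet> \<gamma> s)"
      by (simp add: H_def)
    finally have "2 * (\<gamma> s \<bullet> f (\<gamma> s, u s)) \<le> H s * (1 + \<gamma> s \<bullet> \<gamma> s)" .
    then show ?thesis
      unfolding D_def using pos by (simp add: pos_divide_le_eq)
  qed
  ultimately have "ln (1 + \<gamma> t \<bullet> \<gamma> t) - ln (1 + \<gamma> 0 \<bullet> \<gamma> 0) \<le> integral {0..t} H"
    by (rule has_integral_le)
  also have "\<dots> \<le> integral {0..T} H"
    by (rule integral_subset_le[OF _ Ht has_integral_integrable[OF HT]])
      (use t \<open>cf \<ge> 0\<close> in \<open>auto simp: H_def\<close>)
  also have "\<dots> = (LINT s|lebesgue_on {0..T}. H s)"
    using HT by (rule integral_unique)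
  also have "\<dots> = 4 * cf * (2 * T + (LINT s|lebesgue_on {0..T}. (norm (u s))\<^sup>2))"
    unfolding H_def using u2 t by (simp add: integrable_const_ivl measure_restrict_space)
  finally show ?thesis by simp
qed

section \<open>Stopping a trajectory at an equilibrium\<close>

lemma integrable_extend_by_zero:
  fixes f :: "'a::euclidean_space \<Rightarrow> 'b::euclidean_space"
  assumes "integrable (lebesgue_on S) f" "S \<in> sets lebesgue" "T \<in> sets lebesgue"
  shows "integrable (lebesgue_on T) (\<lambda>x. if x \<in> S then f x else 0)"
proof -
  have "integrable lebesgue (\<lambda>x. if x \<in> S then f x else 0)"
    using assms by (simp add: Lebesgue_Measure.integrable_restrict_UNIV)
  then have "integrable lebesgue (\<lambda>x. indicator T x *\<^sub>R (if x \<in> S then f x else 0))"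
    by (rule integrable_mult_indicator[OF assms(3)])
  then show ?thesis
    using assms(3) by (subst integrable_restrict_space) simp_all
qed

text \<open>A trajectory is continuous, hence bounded, so along it \<open>L\<close> is at most a constant times
  \<open>1 + norm u\<^sup>2\<close>, which is integrable; the constant lower bound controls the negative part on the
  bounded interval.  Integrability matters because the Bochner integral of a nonintegrable function
  is \<open>0\<close> by convention, and costs could then not be compared.\<close>

lemma running_cost_integrable:
  fixes L :: "(real ^ 'd) \<times> (real ^ 'm) \<Rightarrow> real"
  assumes L: "continuous_on UNIV L"
    and upper: "\<And>x u. L (x, u) \<le> \<beta> (norm x) * (1 + (norm u)\<^sup>2)" and \<beta>: "mono_on {0..} \<beta>"
    and lower: "\<And>x u. \<alpha> \<le> L (x, u)"
    and tr: "(\<gamma>, u) \<in> trajectories f 0 T"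
  shows "integrable (lebesgue_on {0..T}) (\<lambda>s. L (\<gamma> s, u s))"
proof -
  have ac: "abs_continuous_on_interval 0 T \<gamma>"
    and um: "u \<in> borel_measurable (lebesgue_on {0..T})"
    and u2: "integrable (lebesgue_on {0..T}) (\<lambda>t. (norm (u t))\<^sup>2)"
    using tr by (auto simp: trajectories_def L2_on_interval_def)
  have cont: "continuous_on {0..T} \<gamma>"
    by (rule abs_continuous_on_interval_imp_continuous_on[OF ac])
  have "bounded (\<gamma> ` {0..T})"
    by (intro compact_imp_bounded compact_continuous_image cont) simp
  then obtain M where M: "\<And>s. s \<in> {0..T} \<Longrightarrow> norm (\<gamma> s) \<le> M"
    unfolding bounded_iff by blast
  define B where "B = \<bar>\<beta> (max 0 M)\<bar>"
  show ?thesis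
  proof (rule Bochner_Integration.integrable_bound)
    show "integrable (lebesgue_on {0..T}) (\<lambda>s. \<bar>\<alpha>\<bar> + B * (1 + (norm (u s))\<^sup>2))"
      using u2 by simp
    have "\<gamma> \<in> borel_measurable (lebesgue_on {0..T})"
      by (rule continuous_imp_measurable_on_sets_lebesgue[OF cont]) simp
    then show "(\<lambda>s. L (\<gamma> s, u s)) \<in> borel_measurable (lebesgue_on {0..T})"
      by (intro borel_measurable_continuous_on[OF L] borel_measurable_Pair um)
    have "\<bar>L (\<gamma> s, u s)\<bar> \<le> \<bar>\<alpha>\<bar> + B * (1 + (norm (u s))\<^sup>2)" if "s \<in> {0..T}" for s
    proof -
      have "\<beta> (norm (\<gamma> s)) \<le> \<beta> (max 0 M)"
        by (rule mono_onD[OF \<beta>]) (use M[OF that] in auto)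
      then have "\<beta> (norm (\<gamma> s)) \<le> B" by (simp add: B_def)
      then have "\<beta> (norm (\<gamma> s)) * (1 + (norm (u s))\<^sup>2) \<le> B * (1 + (norm (u s))\<^sup>2)"
        by (rule mult_right_mono) simp
      with upper have "L (\<gamma> s, u s) \<le> B * (1 + (norm (u s))\<^sup>2)" by (rule order_trans)
      moreover have "0 \<le> B * (1 + (norm (u s))\<^sup>2)" by (simp add: B_def)
      ultimately show ?thesis using lower[of "\<gamma> s" "u s"] by linarith
    qed
    then show "AE s in lebesgue_on {0..T}. norm (L (\<gamma> s, u s)) \<le> norm (\<bar>\<alpha>\<bar> + B * (1 + (norm (u s))\<^sup>2))"
      by (intro AE_I2) (force simp: space_restrict_space)
  qed
qed

lemma trajectory_stop_at_equilibrium: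
  assumes tr: "(\<gamma>, u) \<in> trajectories f 0 a" and end_pt: "\<gamma> a = xs" and eq: "f (xs, us) = 0"
    and "0 \<le> a" "a \<le> T"
  shows "((\<lambda>t. \<gamma> (min t a)), (\<lambda>t. if t \<le> a then u t else us)) \<in> trajectories f 0 T"
proof -
  let ?\<gamma> = "\<lambda>t. \<gamma> (min t a)" and ?u = "\<lambda>t. if t \<le> a then u t else us"
  have ac: "abs_continuous_on_interval 0 a \<gamma>"
    and um: "u \<in> borel_measurable (lebesgue_on {0..a})"
    and u2: "integrable (lebesgue_on {0..a}) (\<lambda>t. (norm (u t))\<^sup>2)"
    and der: "AE t in lebesgue_on {0..a}. (\<gamma> has_vector_derivative f (\<gamma> t, u t)) (at t within {0..a})"
    using tr by (auto simp: trajectories_def L2_on_interval_def)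
  have "abs_continuous_on_interval 0 T ?\<gamma>"
    by (rule abs_continuous_on_interval_transfer[OF ac, where r = "\<lambda>t. min t a" and C = 1])
      (use \<open>0 \<le> a\<close> in auto)
  moreover have "?u \<in> borel_measurable (lebesgue_on {0..T})"
  proof -
    have "(\<lambda>t. if t \<in> {0..a} then u t else 0) \<in> borel_measurable lebesgue"
      by (subst borel_measurable_if) (use um in auto)
    then have "(\<lambda>t. if t \<in> {..a} then if t \<in> {0..a} then u t else 0 else us) \<in> borel_measurable lebesgue"
      by (rule measurable_If_set) simp_all
    then have "(\<lambda>t. if t \<in> {..a} then if t \<in> {0..a} then u t else 0 else us)
        \<in> borel_measurable (lebesgue_on {0..T})"
      by (rule measurable_restrict_space1)
    then show ?thesis
      by (rule measurable_lebesgue_cong[THEN iffD1, rotated]) auto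
  qed
  moreover have "integrable (lebesgue_on {0..T}) (\<lambda>t. (norm (?u t))\<^sup>2)"
  proof -
    have "integrable (lebesgue_on {0..T}) (\<lambda>t. if t \<in> {0..a} then (norm (u t))\<^sup>2 else 0)"
      using u2 by (intro integrable_extend_by_zero) auto
    then have "integrable (lebesgue_on {0..T}) (\<lambda>t. (if t \<in> {0..a} then (norm (u t))\<^sup>2 else 0) + (norm us)\<^sup>2)"
      by simp
    then show ?thesis
    proof (rule Bochner_Integration.integrable_bound)
      show "(\<lambda>t. (norm (?u t))\<^sup>2) \<in> borel_measurable (lebesgue_on {0..T})"
        using \<open>?u \<in> borel_measurable (lebesgue_on {0..T})\<close> by measurable
    qed (auto intro!: AE_I2 simp: space_restrict_space)
  qed
  \<comment> \<open>The two pieces need not have equal one-sided derivatives at \<open>a\<close>, but a single point is a null set.\<close>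
  moreover have "AE t in lebesgue_on {0..T}. (?\<gamma> has_vector_derivative f (?\<gamma> t, ?u t)) (at t within {0..T})"
  proof -
    have "AE t in lebesgue. t \<in> {0..a} \<longrightarrow> (\<gamma> has_vector_derivative f (\<gamma> t, u t)) (at t within {0..a})"
      using der by (subst (asm) AE_restrict_space_iff) auto
    moreover have "AE t in lebesgue. t \<noteq> a"
      by (rule AE_I'[of "{a}"]) (auto simp: negligible_iff_null_sets[symmetric])
    ultimately have "AE t in lebesgue. t \<in> {0..T} \<longrightarrow>
        (?\<gamma> has_vector_derivative f (?\<gamma> t, ?u t)) (at t within {0..T})"
    proof eventually_elim
      case (elim t)
      show ?case
      proof
        assume t: "t \<in> {0..T}"
        consider "t < a" | "a < t" using elim(2) by linarith
        then show "(?\<gamma> has_vector_derivative f (?\<gamma> t, ?u t)) (at t within {0..T})"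
        proof cases
          case 1
          have "at t within {0..T} = at t within {0..a}"
            by (rule at_within_nhd[of _ "{..<a}"]) (use 1 \<open>a \<le> T\<close> in auto)
          moreover have "(\<gamma> has_vector_derivative f (\<gamma> t, u t)) (at t within {0..a})"
            using elim(1) 1 t by simp
          then have "(?\<gamma> has_vector_derivative f (\<gamma> t, u t)) (at t within {0..a})"
            by (rule has_vector_derivative_transform[rotated 2]) (use 1 t in auto)
          ultimately show ?thesis using 1 by simp
        next
          case 2
          have "((\<lambda>_. xs) has_vector_derivative 0) (at t within {0..T})" by simp
          then have "(?\<gamma> has_vector_derivative 0) (at t within {0..T})"
            by (rule has_vector_derivative_transform_within[where d = "t - a"])
              (use 2 t end_pt in \<open>auto simp: dist_real_def\<close>)
          then show ?thesis using 2 eq end_pt by simp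
        qed
      qed
    qed
    then show ?thesis by (subst AE_restrict_space_iff) auto
  qed
  ultimately show ?thesis by (simp add: trajectories_def L2_on_interval_def)
qed

section \<open>Bounds on the value function\<close>

lemma const_mult_length_le_integral:
  fixes \<alpha> :: real
  assumes int: "integrable (lebesgue_on {0..T}) c" and lower: "\<And>s. \<alpha> \<le> c s" and "0 \<le> T"
  shows "\<alpha> * T \<le> (LINT s|lebesgue_on {0..T}. c s)"
proof -
  have "\<alpha> * T = (LINT s|lebesgue_on {0..T}. \<alpha>)"
    using \<open>0 \<le> T\<close> by (simp add: measure_restrict_space)
  also have "\<dots> \<le> (LINT s|lebesgue_on {0..T}. c s)"
    by (rule integral_mono) (use int lower in auto)
  finally show ?thesis .
qed

text \<open>Up to time \<open>a\<close> the cost exceeds \<open>\<alpha>\<close> by at most \<open>\<bar>\<beta> M\<bar> (1 + norm u\<^sup>2) + \<bar>\<alpha>\<bar>\<close>, afterwards it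
  equals \<open>\<alpha>\<close>.  So the excess over \<open>\<alpha> T\<close> does not depend on \<open>T\<close>.  The absolute values are there
  because \<open>\<beta>\<close> and \<open>\<alpha>\<close> may be negative.\<close>

lemma stopped_cost_le:
  fixes L :: "(real ^ 'd) \<times> (real ^ 'm) \<Rightarrow> real"
  assumes int: "integrable (lebesgue_on {0..T}) (\<lambda>s. L (\<gamma> (min s a), if s \<le> a then u s else us))"
    and upper: "\<And>x u. L (x, u) \<le> \<beta> (norm x) * (1 + (norm u)\<^sup>2)" and \<beta>: "mono_on {0..} \<beta>"
    and rest: "L (\<gamma> a, us) = \<alpha>"
    and u2: "integrable (lebesgue_on {0..a}) (\<lambda>s. (norm (u s))\<^sup>2)"
    and M: "\<And>s. s \<in> {0..a} \<Longrightarrow> norm (\<gamma> s) \<le> M"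
    and a: "0 \<le> a" "a \<le> T"
  shows "(LINT s|lebesgue_on {0..T}. L (\<gamma> (min s a), if s \<le> a then u s else us))
    \<le> \<alpha> * T + (\<bar>\<beta> M\<bar> * (a + (LINT s|lebesgue_on {0..a}. (norm (u s))\<^sup>2)) + \<bar>\<alpha>\<bar> * a)"
proof -
  let ?h = "\<lambda>s. \<bar>\<beta> M\<bar> * (1 + (norm (u s))\<^sup>2) + \<bar>\<alpha>\<bar>"
  have h: "integrable (lebesgue_on {0..a}) ?h"
    using u2 by simp
  have h0: "integrable (lebesgue_on {0..T}) (\<lambda>s. if s \<in> {0..a} then ?h s else 0)"
    by (rule integrable_extend_by_zero[OF h]) auto
  have "(LINT s|lebesgue_on {0..T}. L (\<gamma> (min s a), if s \<le> a then u s else us))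
      \<le> (LINT s|lebesgue_on {0..T}. \<alpha> + (if s \<in> {0..a} then ?h s else 0))"
  proof (rule integral_mono[OF int])
    show "integrable (lebesgue_on {0..T}) (\<lambda>s. \<alpha> + (if s \<in> {0..a} then ?h s else 0))"
      using h0 by (intro Bochner_Integration.integrable_add) auto
    fix s assume "s \<in> space (lebesgue_on {0..T})"
    then have s: "s \<in> {0..T}" by (simp add: space_restrict_space)
    show "L (\<gamma> (min s a), if s \<le> a then u s else us) \<le> \<alpha> + (if s \<in> {0..a} then ?h s else 0)"
    proof (cases "s \<le> a")
      case True
      with s have sa: "s \<in> {0..a}" by simp
      have "\<beta> (norm (\<gamma> s)) \<le> \<beta> M"
        by (rule mono_onD[OF \<beta>]) (use M[OF sa] order_trans[OF norm_ge_zero M[OF sa]] in auto)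
      then have "\<beta> (norm (\<gamma> s)) \<le> \<bar>\<beta> M\<bar>" by simp
      then have "\<beta> (norm (\<gamma> s)) * (1 + (norm (u s))\<^sup>2) \<le> \<bar>\<beta> M\<bar> * (1 + (norm (u s))\<^sup>2)"
        by (rule mult_right_mono) simp
      with upper have "L (\<gamma> s, u s) \<le> \<bar>\<beta> M\<bar> * (1 + (norm (u s))\<^sup>2)" by (rule order_trans)
      with True sa show ?thesis by (simp add: min_def)
    next
      case False
      then show ?thesis using rest by (simp add: min_def)
    qed
  qed
  also have "\<dots> = (LINT s|lebesgue_on {0..T}. \<alpha>) + (LINT s|lebesgue_on {0..T}. (if s \<in> {0..a} then ?h s else 0))"
    by (rule Bochner_Integration.integral_add[OF _ h0]) simp
  also have "(LINT s|lebesgue_on {0..T}. (if s \<in> {0..a} then ?h s else 0)) = (LINT s|lebesgue_on {0..a}. ?h s)"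
    by (subst Lebesgue_Measure.integral_restrict_Int) (use a in \<open>auto simp: Int_absorb2\<close>)
  also have "\<dots> = \<bar>\<beta> M\<bar> * (a + (LINT s|lebesgue_on {0..a}. (norm (u s))\<^sup>2)) + \<bar>\<alpha>\<bar> * a"
    using u2 a by (simp add: measure_restrict_space)
  also have "(LINT s|lebesgue_on {0..T}. \<alpha>) = \<alpha> * T"
    using a by (simp add: measure_restrict_space)
  finally show ?thesis .
qed

text \<open>The competitor for the upper bound steers \<open>x\<close> to the equilibrium and rests there.  The radius
  \<open>R'\<close> is chosen so that the ball contains both \<open>x\<close> and \<open>xs\<close>.\<close>

lemma value_fun_bounds:
  fixes f :: "(real ^ 'd) \<times> (real ^ 'm) \<Rightarrow> real ^ 'd"
    and L :: "(real ^ 'd) \<times> (real ^ 'm) \<Rightarrow> real"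
  assumes L: "continuous_on UNIV L"
    and growth: "\<And>x u. norm (f (x, u)) \<le> cf * (1 + norm u) * (1 + norm x)" "cf \<ge> 0"
    and upper: "\<And>x u. L (x, u) \<le> \<beta> (norm x) * (1 + (norm u)\<^sup>2)" and \<beta>: "mono_on {0..} \<beta>"
    and lower: "\<And>x u. L (xs, us) \<le> L (x, u)" and eq: "f (xs, us) = 0"
    and lugc: "LUGC f" and "R \<ge> 0"
  shows "\<exists>a C. \<forall>T\<ge>a. \<forall>x\<in>cball 0 R.
    L (xs, us) * T \<le> value_fun f L T x \<and> value_fun f L T x \<le> L (xs, us) * T + C"
proof -
  let ?\<alpha> = "L (xs, us)"
  define R' where "R' = max R (norm xs)"
  have "R' \<ge> 0" using \<open>R \<ge> 0\<close> by (simp add: R'_def)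
  with lugc obtain a C where "a \<ge> 0" and steer:
    "\<forall>x\<in>cball 0 R'. \<forall>y\<in>cball 0 R'. \<exists>(\<gamma>, u)\<in>trajectories_from_to f 0 a x y.
          (LINT s|lebesgue_on {0..a}. (norm (u s))\<^sup>2) \<le> C"
    unfolding LUGC_def by blast
  \<comment> \<open>\<open>M\<close> bounds \<open>1 + norm (\<gamma> s)\<^sup>2\<close>, and therefore \<open>norm (\<gamma> s)\<close>, for every steering trajectory.\<close>
  define M where "M = exp (ln (1 + R\<^sup>2) + 4 * cf * (2 * a + C))"
  show ?thesis
  proof (intro exI allI ballI impI)
    fix T and x :: "real ^ 'd" assume "a \<le> T" and x: "x \<in> cball 0 R"
    then have "0 \<le> T" using \<open>a \<ge> 0\<close> by simp
    have "x \<in> cball 0 R'" "xs \<in> cball 0 R'" using x by (auto simp: R'_def)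
    with steer obtain \<gamma> u where "(\<gamma>, u) \<in> trajectories_from_to f 0 a x xs"
      and C: "(LINT s|lebesgue_on {0..a}. (norm (u s))\<^sup>2) \<le> C"
      by fast
    then have tr: "(\<gamma>, u) \<in> trajectories f 0 a" and ends: "\<gamma> 0 = x" "\<gamma> a = xs"
      by (auto simp: trajectories_from_to_def trajectories_from_def trajectories_to_def)
    have M: "norm (\<gamma> s) \<le> M" if "s \<in> {0..a}" for s
    proof -
      have "ln (1 + \<gamma> s \<bullet> \<gamma> s) \<le> ln (1 + \<gamma> 0 \<bullet> \<gamma> 0)
          + 4 * cf * (2 * a + (LINT s|lebesgue_on {0..a}. (norm (u s))\<^sup>2))"
        by (rule trajectory_log_energy_le[OF growth tr that])
      also have "\<dots> \<le> ln (1 + R\<^sup>2) + 4 * cf * (2 * a + C)"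
      proof (intro add_mono mult_left_mono order_refl C)
        have "x \<bullet> x \<le> R\<^sup>2"
          using x power_mono[of "norm x" R 2] by (simp add: power2_norm_eq_inner)
        then show "ln (1 + \<gamma> 0 \<bullet> \<gamma> 0) \<le> ln (1 + R\<^sup>2)"
          using ends by (simp add: add_pos_nonneg)
      qed (use growth in auto)
      finally have "exp (ln (1 + \<gamma> s \<bullet> \<gamma> s)) \<le> M" by (simp only: M_def exp_le_cancel_iff)
      then have "1 + (norm (\<gamma> s))\<^sup>2 \<le> M" by (simp add: power2_norm_eq_inner add_pos_nonneg)
      moreover have "0 \<le> (norm (\<gamma> s) - 1)\<^sup>2 + (norm (\<gamma> s))\<^sup>2 + 1" by simp
      then have "2 * norm (\<gamma> s) \<le> 2 * (1 + (norm (\<gamma> s))\<^sup>2)" by (simp add: power2_diff)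
      ultimately show ?thesis by simp
    qed
    let ?\<gamma> = "\<lambda>t. \<gamma> (min t a)" and ?u = "\<lambda>t. if t \<le> a then u t else us"
    have stopped: "(?\<gamma>, ?u) \<in> trajectories f 0 T"
      by (rule trajectory_stop_at_equilibrium[OF tr ends(2) eq \<open>0 \<le> a\<close> \<open>a \<le> T\<close>])
    then have from_x: "(?\<gamma>, ?u) \<in> trajectories_from f 0 T x"
      using ends \<open>0 \<le> a\<close> by (simp add: trajectories_from_def)
    let ?J = "\<lambda>(\<gamma>, u). LINT s|lebesgue_on {0..T}. L (\<gamma> s, u s)"
    have J: "?\<alpha> * T \<le> ?J p" if "p \<in> trajectories_from f 0 T x" for p
    proof (cases p)
      case (Pair \<eta> w)
      with that have "(\<eta>, w) \<in> trajectories f 0 T" by (simp add: trajectories_from_def)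
      then have "integrable (lebesgue_on {0..T}) (\<lambda>s. L (\<eta> s, w s))"
        by (rule running_cost_integrable[OF L upper \<beta> lower])
      then show ?thesis
        unfolding Pair prod.case by (rule const_mult_length_le_integral[OF _ lower \<open>0 \<le> T\<close>])
    qed
    have "?\<alpha> * T \<le> value_fun f L T x"
      unfolding value_fun_def by (rule cINF_greatest) (use from_x J in auto)
    moreover have "value_fun f L T x \<le> ?J (?\<gamma>, ?u)"
      unfolding value_fun_def by (rule cINF_lower[OF bdd_belowI2[OF J] from_x])
    moreover have "?J (?\<gamma>, ?u) \<le> ?\<alpha> * T
        + (\<bar>\<beta> M\<bar> * (a + (LINT s|lebesgue_on {0..a}. (norm (u s))\<^sup>2)) + \<bar>?\<alpha>\<bar> * a)"
      unfolding prod.case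
      by (rule stopped_cost_le[OF running_cost_integrable[OF L upper \<beta> lower stopped] upper \<beta> _ _ M \<open>0 \<le> a\<close> \<open>a \<le> T\<close>])
        (use tr ends in \<open>auto simp: trajectories_def L2_on_interval_def\<close>)
    moreover have "\<bar>\<beta> M\<bar> * (a + (LINT s|lebesgue_on {0..a}. (norm (u s))\<^sup>2)) \<le> \<bar>\<beta> M\<bar> * (a + C)"
      using C by (intro mult_left_mono) auto
    ultimately show "?\<alpha> * T \<le> value_fun f L T x \<and>
        value_fun f L T x \<le> ?\<alpha> * T + (\<bar>\<beta> M\<bar> * (a + C) + \<bar>?\<alpha>\<bar> * a)"
      by linarith
  qed
qed

section \<open>The long-time average\<close>

theorem theorem5p3:
  fixes f :: "(real ^ 'd) \<times> (real ^ 'm) \<Rightarrow> real ^ 'd"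
    and L :: "(real ^ 'd) \<times> (real ^ 'm) \<Rightarrow> real"
    and us :: "real ^ 'm"
  assumes "continuous_on UNIV f"
    and "C2 L"
    and "F0 f"
    and "L1 L"
    and "L2 L us"
    and "L3 f L us"
    and "LUGC f"
  shows "\<exists>\<alpha>::real. \<forall>R>0.
    ((\<lambda>T::real. SUP x\<in>cball 0 R. ereal \<bar>1 / T * value_fun f L T x - \<alpha>\<bar>) \<longlongrightarrow> 0) at_top"
proof -
  obtain cf where cf: "cf \<ge> 0" "\<And>x u. norm (f (x, u)) \<le> cf * (1 + norm u) * (1 + norm x)"
    using \<open>F0 f\<close> unfolding F0_def by blast
  obtain \<beta> where \<beta>: "mono_on {0..} \<beta>" "\<And>x u. L (x, u) \<le> \<beta> (norm x) * (1 + (norm u)\<^sup>2)"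
    using \<open>L1 L\<close> unfolding L1_def by blast
  obtain K \<Theta> xs where "\<Theta> > 0" and xs: "is_arg_min (\<lambda>x. L (x, us)) (\<lambda>x. x \<in> K) xs" "f (xs, us) = 0"
    and far: "\<And>u. (INF x\<in>-K. ereal (L (x, u))) \<ge> ereal (\<Theta> + L (xs, us))"
    using \<open>L3 f L us\<close> unfolding L3_def by blast
  have lower: "L (xs, us) \<le> L (x, u)" for x u
  proof (cases "x \<in> K")
    case True
    then have "L (xs, us) \<le> L (x, us)"
      using xs(1) by (auto simp: is_arg_min_def not_less)
    also have "\<dots> \<le> L (x, u)"
      using \<open>L2 L us\<close> by (simp add: L2_def)
    finally show ?thesis .
  next
    case False
    then have "(INF x\<in>-K. ereal (L (x, u))) \<le> ereal (L (x, u))"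
      by (intro INF_lower) simp
    with far[of u] have "ereal (\<Theta> + L (xs, us)) \<le> ereal (L (x, u))"
      by (rule order_trans)
    with \<open>\<Theta> > 0\<close> show ?thesis by simp
  qed
  obtain L' where L': "\<forall>z. (L has_derivative blinfun_apply (L' z)) (at z)"
    using \<open>C2 L\<close> unfolding C2_def by blast
  have L: "continuous_on UNIV L"
    by (intro continuous_at_imp_continuous_on ballI has_derivative_continuous[OF L'[THEN spec]])
  show ?thesis
  proof (intro exI allI impI)
    fix R :: real assume "R > 0"
    obtain a C where V: "\<forall>T\<ge>a. \<forall>x\<in>cball 0 R.
        L (xs, us) * T \<le> value_fun f L T x \<and> value_fun f L T x \<le> L (xs, us) * T + C"
      using value_fun_bounds[OF L cf(2,1) \<beta>(2,1) lower xs(2) \<open>LUGC f\<close> less_imp_le[OF \<open>R > 0\<close>]] by blast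
    let ?S = "\<lambda>T. SUP x\<in>cball 0 R. ereal \<bar>1 / T * value_fun f L T x - L (xs, us)\<bar>"
    have "((\<lambda>T. C / T) \<longlongrightarrow> 0) at_top"
      by (rule real_tendsto_divide_at_top[OF tendsto_const filterlim_ident])
    then have lim: "((\<lambda>T. ereal (C / T)) \<longlongrightarrow> 0) at_top"
      unfolding zero_ereal_def by (rule tendsto_ereal)
    show "(?S \<longlongrightarrow> 0) at_top"
    proof (rule tendsto_sandwich[OF _ _ tendsto_const lim])
      have "0 \<le> ?S T" for T
        by (rule SUP_upper2[of 0]) (use \<open>R > 0\<close> in auto)
      then show "\<forall>\<^sub>F T in at_top. 0 \<le> ?S T" by simp
      show "\<forall>\<^sub>F T in at_top. ?S T \<le> ereal (C / T)"
        using eventually_ge_at_top[of a] eventually_gt_at_top[of 0]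
      proof eventually_elim
        case (elim T)
        show ?case
        proof (rule SUP_least)
          fix x :: "real ^ 'd" assume "x \<in> cball 0 R"
          with V elim(1) have "0 \<le> value_fun f L T x - L (xs, us) * T" "value_fun f L T x - L (xs, us) * T \<le> C"
            by force+
          moreover have "1 / T * value_fun f L T x - L (xs, us) = (value_fun f L T x - L (xs, us) * T) / T"
            using elim(2) by (simp add: field_simps)
          ultimately show "ereal \<bar>1 / T * value_fun f L T x - L (xs, us)\<bar> \<le> ereal (C / T)"
            using elim(2) by (simp add: abs_divide divide_right_mono)
        qed
      qed
    qed
  qed
qed

end
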